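(* Let $X=(X,\succcurlyeq)$ be a radially ordered metric space. If $X$ is connected, then $\succcurlyeq$ is either trivial or total.
   Context: For a partial order $\succcurlyeq$ (reflexive, transitive, antisymmetric relation) on a nonempty set $X$: $x\succ y$ means $x\succcurlyeq y$ and $x\neq y$; $x\succcurlyeq^{\bullet}y$ means that $y\succcurlyeq x$ does not hold. The order is trivial if it is the equality relation, and total if for all $x,y\in X$ either $x\succcurlyeq y$ or $y\succcurlyeq x$. A radially ordered metric space is a metric space $(X,d)$ together with a partial order $\succcurlyeq$ on $X$ such that for all $x,y,z\in X$: (i) $x\succcurlyeq^{\bullet}y\succ z$ implies $d(x,z)\geq d(x,y)$; and (ii) $x\succ y\succcurlyeq^{\bullet}z$ implies $d(x,z)\geq d(y,z)$. *)

theory Defs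
  imports "HOL-Analysis.Abstract_Metric_Spaces"
begin

text \<open>
  The relation is a binary predicate on the ambient type; only its restriction to the carrier
  of the metric space is ever constrained or observed.
\<close>

definition strict_part :: "('a \<Rightarrow> 'a \<Rightarrow> bool) \<Rightarrow> 'a \<Rightarrow> 'a \<Rightarrow> bool" where
  "strict_part ge x y \<longleftrightarrow> ge x y \<and> x \<noteq> y"

definition not_below :: "('a \<Rightarrow> 'a \<Rightarrow> bool) \<Rightarrow> 'a \<Rightarrow> 'a \<Rightarrow> bool" where
  "not_below ge x y \<longleftrightarrow> \<not> ge y x"

definition trivial_order :: "'a set \<Rightarrow> ('a \<Rightarrow> 'a \<Rightarrow> bool) \<Rightarrow> bool" where
  "trivial_order X ge \<longleftrightarrow> (\<forall>x\<in>X. \<forall>y\<in>X. ge x y \<longleftrightarrow> x = y)"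

definition total_order :: "'a set \<Rightarrow> ('a \<Rightarrow> 'a \<Rightarrow> bool) \<Rightarrow> bool" where
  "total_order X ge \<longleftrightarrow> (\<forall>x\<in>X. \<forall>y\<in>X. ge x y \<or> ge y x)"

locale radially_ordered_metric_space = Metric_space X d
  for X :: "'a set" and d :: "'a \<Rightarrow> 'a \<Rightarrow> real" +
  fixes ge :: "'a \<Rightarrow> 'a \<Rightarrow> bool"  (infix "\<succeq>" 50)
  assumes nonempty: "X \<noteq> {}"
    and refl: "reflp_on X (\<succeq>)"
    and trans: "transp_on X (\<succeq>)"
    and antisym: "antisymp_on X (\<succeq>)"
    and radial_left: "\<lbrakk>x \<in> X; y \<in> X; z \<in> X; not_below (\<succeq>) x y; strict_part (\<succeq>) y z\<rbrakk>
      \<Longrightarrow> d x z \<ge> d x y"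
    and radial_right: "\<lbrakk>x \<in> X; y \<in> X; z \<in> X; strict_part (\<succeq>) x y; not_below (\<succeq>) y z\<rbrakk>
      \<Longrightarrow> d x z \<ge> d y z"

end

theory Submission
  imports Defs
begin

text \<open>
  For each point \<open>x\<close>, the points strictly above \<open>x\<close>, strictly below \<open>x\<close> and incomparable to \<open>x\<close>
  form three open sets that partition \<open>X - {x}\<close>: the radial inequalities bound from below the
  distance between two points lying in different classes, in terms of their distance to \<open>x\<close>.
  So only \<open>x\<close> itself can obstruct the
  closedness of any of these sets, and connectedness is exploited through clopen sets from
  which this obstruction has been removed.

  If \<open>x\<close> and \<open>y\<close> are incomparable, the set of common strict upper bounds is such a clopen set,
  since the exceptional point \<open>x\<close> is incomparable to \<open>y\<close> and vice versa. As it omits \<open>x\<close>, it is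
  empty; hence everything above \<open>x\<close> is again incomparable to \<open>y\<close>
  (\<open>above_incomparable_subset\<close>). The radial inequalities then give \<open>d z y \<le> d x y\<close> whenever \<open>z\<close>
  is above \<open>x\<close> and \<open>y\<close> is incomparable to \<open>x\<close>, so no such \<open>y\<close> can be closer to \<open>x\<close> than
  \<open>d x z / 2\<close>. This makes the set of points incomparable to \<open>x\<close> clopen as soon as some point
  lies above \<open>x\<close> or, by duality, below \<open>x\<close>; omitting \<open>x\<close>, that set is empty. Thus each point is
  either comparable to all points or comparable only to itself
  (\<open>incomparable_empty_or_isolated\<close>), and a point of the first kind that is comparable to
  another point cannot coexist with a point that is incomparable to some other: the two
  would be comparable, hence equal.
\<close>

context radially_ordered_metric_space
begin

definition above :: "'a \<Rightarrow> 'a set" where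
  "above x = {y \<in> X. y \<succeq> x \<and> y \<noteq> x}"

definition below :: "'a \<Rightarrow> 'a set" where
  "below x = {y \<in> X. x \<succeq> y \<and> y \<noteq> x}"

definition incomparable :: "'a \<Rightarrow> 'a set" where
  "incomparable x = {y \<in> X. \<not> x \<succeq> y \<and> \<not> y \<succeq> x}"

lemmas class_defs = above_def below_def incomparable_def

text \<open>
  The two radial axioms are exchanged by reversing the order, so every result about upper
  bounds yields one about lower bounds.
\<close>

lemma dual_order: "radially_ordered_metric_space X d (\<lambda>x y. y \<succeq> x)"
proof unfold_locales
  show "X \<noteq> {}"
    by (rule nonempty)
  show "reflp_on X (\<lambda>x y. y \<succeq> x)" "transp_on X (\<lambda>x y. y \<succeq> x)" "antisymp_on X (\<lambda>x y. y \<succeq> x)"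
    using refl trans antisym
    unfolding reflp_on_def transp_on_def antisymp_on_def by blast+
next
  fix x y z
  assume X: "x \<in> X" "y \<in> X" "z \<in> X"
  show "d x y \<le> d x z"
    if "not_below (\<lambda>x y. y \<succeq> x) x y" "strict_part (\<lambda>x y. y \<succeq> x) y z"
    using radial_right[of z y x] X that commute[of x y] commute[of x z]
    by (auto simp: not_below_def strict_part_def)
  show "d y z \<le> d x z"
    if "strict_part (\<lambda>x y. y \<succeq> x) x y" "not_below (\<lambda>x y. y \<succeq> x) y z"
    using radial_left[of z y x] X that commute[of y z] commute[of x z]
    by (auto simp: not_below_def strict_part_def)
qed

lemma dual_above: "radially_ordered_metric_space.above X (\<lambda>x y. y \<succeq> x) x = below x"
  by (simp add: radially_ordered_metric_space.above_def[OF dual_order] below_def)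

lemma dual_incomparable:
  "radially_ordered_metric_space.incomparable X (\<lambda>x y. y \<succeq> x) x = incomparable x"
  by (auto simp: radially_ordered_metric_space.incomparable_def[OF dual_order] incomparable_def)

lemma incomparable_sym: "x \<in> X \<Longrightarrow> y \<in> incomparable x \<Longrightarrow> x \<in> incomparable y"
  by (auto simp: incomparable_def)

lemma not_incomparable_self: "x \<in> X \<Longrightarrow> x \<notin> incomparable x"
  using refl by (auto simp: incomparable_def reflp_on_def)

lemma classes_cover: "X - {x} \<subseteq> incomparable x \<union> above x \<union> below x"
  by (auto simp: class_defs)

lemma classes_disjoint:
  assumes "x \<in> X"
  shows "above x \<inter> incomparable x = {}" "below x \<inter> incomparable x = {}"
    "above x \<inter> below x = {}"
  using antisymp_onD[OF antisym] assms unfolding class_defs by blast+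

text \<open>
  A point \<open>z\<close> near \<open>y \<succ> x\<close> that failed to be above \<open>x\<close> would satisfy \<open>d x z \<le> d y z\<close>, so that
  going from \<open>x\<close> to \<open>y\<close> through \<open>z\<close> would be too short.
\<close>

lemma openin_above:
  assumes x: "x \<in> X"
  shows "openin mtopology (above x)"
  unfolding openin_mtopology
proof (intro conjI allI impI)
  show "above x \<subseteq> X"
    by (auto simp: above_def)
next
  fix y
  assume "y \<in> above x"
  then have y: "y \<in> X" "y \<succeq> x" "y \<noteq> x"
    by (auto simp: above_def)
  have "z \<in> above x" if "z \<in> mball y (d x y / 2)" for z
  proof (rule ccontr)
    assume "z \<notin> above x"
    have z: "z \<in> X" "d y z < d x y / 2"
      using that by auto
    have "z \<noteq> x"
      using z x y commute[of x y] mdist_pos_eq[of x y] by auto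
    then have "d x z \<le> d y z"
      using \<open>z \<notin> above x\<close> radial_right[of y x z] x y z
      by (auto simp: above_def not_below_def strict_part_def)
    then show False
      using triangle[of x z y] commute[of y z] x y z by auto
  qed
  then show "\<exists>r>0. mball y r \<subseteq> above x"
    using x y mdist_pos_eq[of x y] by (intro exI[of _ "d x y / 2"]) auto
qed

lemma openin_below: "x \<in> X \<Longrightarrow> openin mtopology (below x)"
  using radially_ordered_metric_space.openin_above[OF dual_order] by (simp add: dual_above)

text \<open>
  If \<open>y\<close> is incomparable to \<open>x\<close>, every point other than \<open>x\<close> that is comparable to \<open>x\<close> is at least
  as far from \<open>y\<close> as \<open>x\<close> is: upper bounds by the second radial axiom, lower bounds by the first.
\<close>

lemma openin_incomparable:
  assumes x: "x \<in> X"
  shows "openin mtopology (incomparable x)"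
  unfolding openin_mtopology
proof (intro conjI allI impI)
  show "incomparable x \<subseteq> X"
    by (auto simp: incomparable_def)
next
  fix y
  assume "y \<in> incomparable x"
  then have y: "y \<in> X" "\<not> x \<succeq> y" "\<not> y \<succeq> x"
    by (auto simp: incomparable_def)
  then have "x \<noteq> y"
    using refl x by (auto simp: reflp_on_def)
  have "z \<in> incomparable x" if "z \<in> mball y (d x y)" for z
  proof (rule ccontr)
    assume "z \<notin> incomparable x"
    have z: "z \<in> X" "d y z < d x y"
      using that by auto
    have "z \<noteq> x"
      using z commute[of x y] by auto
    then consider "z \<succeq> x" "z \<noteq> x" | "x \<succeq> z" "z \<noteq> x"
      using \<open>z \<notin> incomparable x\<close> z by (auto simp: incomparable_def)
    then show False
    proof cases
      case 1
      then show False
        using radial_right[of z x y] x y z commute[of y z]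
        by (auto simp: not_below_def strict_part_def)
    next
      case 2
      then show False
        using radial_left[of y x z] x y z commute[of x y]
        by (auto simp: not_below_def strict_part_def)
    qed
  qed
  then show "\<exists>r>0. mball y r \<subseteq> incomparable x"
    using x y \<open>x \<noteq> y\<close> mdist_pos_eq[of x y] by (intro exI[of _ "d x y"]) auto
qed

lemma clopen_empty:
  assumes "connected_space mtopology"
    and "openin mtopology A" "openin mtopology (X - A)" "x \<in> X" "x \<notin> A"
  shows "A = {}"
  using assms openin_subset[OF assms(2)]
  by (auto simp: connected_space_clopen_in closedin_def)

text \<open>
  Connectedness rules out common strict upper bounds of incomparable points; a point above \<open>x\<close>
  cannot be below \<open>y\<close> by transitivity, so incomparability is the only case left.
\<close>

lemma above_incomparable_subset:
  assumes conn: "connected_space mtopology"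
    and x: "x \<in> X" and y: "y \<in> incomparable x"
  shows "above x \<subseteq> incomparable y"
proof -
  have yX: "y \<in> X"
    using y by (auto simp: incomparable_def)
  have xy: "x \<in> incomparable y"
    using incomparable_sym[OF x y] .
  have "above x \<inter> above y = {}"
  proof (rule clopen_empty[OF conn])
    show "openin mtopology (above x \<inter> above y)"
      using openin_above x yX by blast
    \<comment> \<open>The centres \<open>x\<close> and \<open>y\<close>, missing from their own classes, are covered by each other's.\<close>
    have "X - above x \<inter> above y = (incomparable x \<union> below x) \<union> (incomparable y \<union> below y)"
      (is "_ = ?R")
    proof
      show "X - above x \<inter> above y \<subseteq> ?R"
        using classes_cover[of x] classes_cover[of y] xy y by blast
      have "?R \<subseteq> X"
        by (auto simp: class_defs)
      then show "?R \<subseteq> X - above x \<inter> above y"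
        using classes_disjoint[OF x] classes_disjoint[OF yX] by blast
    qed
    then show "openin mtopology (X - above x \<inter> above y)"
      by (simp add: openin_Un openin_below openin_incomparable x yX)
    show "x \<in> X" "x \<notin> above x \<inter> above y"
      using x by (auto simp: above_def)
  qed
  moreover have "z \<notin> below y" "z \<noteq> y" if "z \<in> above x" for z
    using that transp_onD[OF trans x, of z y] transp_onD[OF trans yX, of z x] x y yX
    unfolding class_defs by blast+
  moreover have "above x \<subseteq> X"
    by (auto simp: above_def)
  ultimately show ?thesis
    using classes_cover[of y] by blast
qed

text \<open>
  Points incomparable to \<open>x\<close> stay away from \<open>x\<close>: for \<open>z\<close> above \<open>x\<close> and \<open>y\<close> incomparable to \<open>x\<close>,
  hence to \<open>z\<close>, the first radial axiom gives \<open>d y z \<le> d y x\<close>, so \<open>d x z \<le> 2 * d x y\<close>.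
\<close>

lemma incomparable_empty_if_above:
  assumes conn: "connected_space mtopology"
    and x: "x \<in> X" and z: "z \<in> above x"
  shows "incomparable x = {}"
proof (rule clopen_empty[OF conn openin_incomparable[OF x] _ x not_incomparable_self[OF x]])
  have zX: "z \<in> X" "z \<succeq> x" "z \<noteq> x"
    using z by (auto simp: above_def)
  have far: "mball x (d x z / 2) \<inter> incomparable x = {}"
  proof -
    have "d x z / 2 \<le> d x y" if y: "y \<in> incomparable x" for y
    proof -
      have yX: "y \<in> X"
        using y by (auto simp: incomparable_def)
      have "z \<in> incomparable y"
        using above_incomparable_subset[OF conn x y] z by blast
      then have "d y z \<le> d y x"
        using radial_left[of y z x] x yX zX
        by (auto simp: incomparable_def not_below_def strict_part_def)
      then show ?thesis
        using triangle[of x y z] commute[of x y] x yX zX by auto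
    qed
    then show ?thesis
      by force
  qed
  have "x \<in> mball x (d x z / 2)"
    using x zX mdist_pos_eq[of x z] by auto
  then have "X - incomparable x = mball x (d x z / 2) \<union> (above x \<union> below x)"
    using far classes_cover[of x] classes_disjoint[OF x]
    by (auto simp: above_def below_def)
  then show "openin mtopology (X - incomparable x)"
    using openin_above[OF x] openin_below[OF x] by auto
qed

lemma incomparable_empty_or_isolated:
  assumes conn: "connected_space mtopology" and x: "x \<in> X"
  shows "incomparable x = {} \<or> above x \<union> below x = {}"
  using incomparable_empty_if_above[OF conn x]
    radially_ordered_metric_space.incomparable_empty_if_above[OF dual_order conn x]
  by (auto simp: dual_above dual_incomparable)

end

theorem theorem4:
  fixes X :: "'a set" and d :: "'a \<Rightarrow> 'a \<Rightarrow> real" and ge :: "'a \<Rightarrow> 'a \<Rightarrow> bool"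
  assumes "radially_ordered_metric_space X d ge"
    and "connected_space (Metric_space.mtopology X d)"
  shows "trivial_order X ge \<or> total_order X ge"
proof (rule ccontr)
  assume neither: "\<not> (trivial_order X ge \<or> total_order X ge)"
  interpret radially_ordered_metric_space X d ge
    by (rule assms(1))
  note dichotomy = incomparable_empty_or_isolated[OF assms(2)]
  obtain a b where a: "a \<in> X" "b \<in> X" "ge a b" "a \<noteq> b"
    using neither refl by (auto simp: trivial_order_def reflp_on_def)
  obtain u v where u: "u \<in> X" "v \<in> X" "\<not> ge u v" "\<not> ge v u"
    using neither by (auto simp: total_order_def)
  have "b \<in> below a" "v \<in> incomparable u"
    using a u by (auto simp: below_def incomparable_def)
  then have "incomparable a = {}" "above u \<union> below u = {}"
    using dichotomy[OF a(1)] dichotomy[OF u(1)] by auto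
  \<comment> \<open>Now \<open>a\<close> and \<open>u\<close> are comparable, which forces \<open>a = u\<close>, although \<open>v\<close> is incomparable to \<open>u\<close>.\<close>
  then have "a = u"
    using a(1) u(1) classes_cover[of u] incomparable_sym[of u a] by blast
  then show False
    using \<open>incomparable a = {}\<close> \<open>v \<in> incomparable u\<close> by auto
qed

end
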